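(* Let $G$ be an Abelian group and let $(a_n)_{n\in\omega}$ be a non-trivial $T$-sequence on $G$ that generates $G$. Then the space of ends of the coarse group $(G,\mathcal{I}_{(a_n)})$ is a singleton.
   Context: A coarse structure on a set $X$ is a family $\mathcal{E}$ of subsets of $X\times X$ such that: each $E\in\mathcal{E}$ contains the diagonal $\triangle_X$; $E,E'\in\mathcal{E}$ implies $E\circ E'\in\mathcal{E}$ and $E^{-1}\in\mathcal{E}$, where $E\circ E'=\{(x,y): \exists z\in X,\ (x,z)\in E,\ (z,y)\in E'\}$ and $E^{-1}=\{(y,x):(x,y)\in E\}$; if $E\in\mathcal{E}$ and $\triangle_X\subseteq E'\subseteq E$ then $E'\in\mathcal{E}$; for all $x,y\in X$ there is $E\in\mathcal{E}$ with $(x,y)\in E$. The pair $(X,\mathcal{E})$ is a coarse space. A subfamily $\mathcal{E}'\subseteq\mathcal{E}$ is a base for $\mathcal{E}$ if every $E\in\mathcal{E}$ is contained in some $E'\in\mathcal{E}'$. Write $E[x]=\{y\in X:(x,y)\in E\}$. A subset $B\subseteq X$ is bounded if $B\subseteq E[x]$ for some $x\in X$ and $E\in\mathcal{E}$. A sequence $(a_n)_{n\in\omega}$ in an Abelian group $G$ is a $T$-sequence if there exists a Hausdorff group topology on $G$ in which $(a_n)$ converges to $0$; $\tau_{(a_n)}$ denotes the strongest group topology on $G$ in which $(a_n)$ converges to $0$. A $T$-sequence is trivial if $a_n=0$ for all but finitely many $n\in\omega$, and non-trivial otherwise. "$(a_n)$ generates $G$" means that the set $\{a_n:n\in\omega\}$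 generates $G$ as a group. $\mathcal{I}_{(a_n)}$ is the ideal of all precompact (equivalently, by completeness of $(G,\tau_{(a_n)})$, totally bounded) subsets of $(G,\tau_{(a_n)})$. The coarse group $(G,\mathcal{I}_{(a_n)})$ is $G$ with the coarse structure having as base of entourages the sets $\{(x,y)\in G\times G: x-y\in P\}$, $P\in\mathcal{I}_{(a_n)}$ with $0\in P$. Ends: let $(X,\mathcal{E})$ be a coarse space. A function $f:X\to\{0,1\}$ is slowly oscillating if for every $E\in\mathcal{E}$ there is a bounded subset $B$ of $X$ such that $f|_{E[x]}$ is constant for each $x\in X\setminus B$. Endow $X$ with the discrete topology, identify its Stone–Čech compactification $\beta X$ with the set of ultrafilters on $X$, and put $X^{\sharp}=\{p\in\beta X: \text{each } P\in p \text{ is unbounded}\}$. For $f:X\to\{0,1\}$ let $f^{\beta}:\beta X\to\{0,1\}$ be its continuous extension. Define an equivalence relation on $X^{\sharp}$ by $p\sim q$ if and only if $f^{\beta}(p)=f^{\beta}(q)$ for every slowly oscillating function $f:X\to\{0,1\}$. The space of ends (binary corona) of $(X,\mathcal{E})$ is the quotient $X^{\sharp}/{\sim}$. *)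

theory Defs
  imports "HOL-Analysis.Analysis" "HOL-Computational_Algebra.Group_Closure"
begin

text \<open>The underlying set of a coarse space is a whole type. The entourages satisfy
  \<open>E `` {x} = E[x]\<close>, and \<open>O\<close> is the composition \<open>E \<circ> E'\<close> in the order used here:
  \<open>(x, y) \<in> E O E'\<close> iff \<open>(x, z) \<in> E\<close> and \<open>(z, y) \<in> E'\<close> for some \<open>z\<close>.\<close>

definition coarse_structure :: "('a \<times> 'a) set set \<Rightarrow> bool" where
  "coarse_structure \<E> \<longleftrightarrow>
     (\<forall>E\<in>\<E>. Id \<subseteq> E) \<and>
     (\<forall>E\<in>\<E>. \<forall>E'\<in>\<E>. E O E' \<in> \<E>) \<and>
     (\<forall>E\<in>\<E>. E\<inverse> \<in> \<E>) \<and>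
     (\<forall>E\<in>\<E>. \<forall>E'. Id \<subseteq> E' \<and> E' \<subseteq> E \<longrightarrow> E' \<in> \<E>) \<and>
     (\<forall>x y. \<exists>E\<in>\<E>. (x, y) \<in> E)"

definition coarse_base :: "('a \<times> 'a) set set \<Rightarrow> ('a \<times> 'a) set set \<Rightarrow> bool" where
  "coarse_base \<B> \<E> \<longleftrightarrow> \<B> \<subseteq> \<E> \<and> (\<forall>E\<in>\<E>. \<exists>B\<in>\<B>. E \<subseteq> B)"

definition coarse_bounded :: "('a \<times> 'a) set set \<Rightarrow> 'a set \<Rightarrow> bool" where
  "coarse_bounded \<E> B \<longleftrightarrow> (\<exists>x. \<exists>E\<in>\<E>. B \<subseteq> E `` {x})"

text \<open>The two-point set \<open>{0, 1}\<close> is rendered as \<^typ>\<open>bool\<close>.\<close>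

definition slowly_oscillating :: "('a \<times> 'a) set set \<Rightarrow> ('a \<Rightarrow> bool) \<Rightarrow> bool" where
  "slowly_oscillating \<E> f \<longleftrightarrow>
     (\<forall>E\<in>\<E>. \<exists>B. coarse_bounded \<E> B \<and> (\<forall>x\<in>UNIV - B. f constant_on E `` {x}))"

definition ultrafilter :: "'a filter \<Rightarrow> bool" where
  "ultrafilter p \<longleftrightarrow> p \<noteq> bot \<and> (\<forall>P. eventually P p \<or> eventually (\<lambda>x. \<not> P x) p)"

definition mem_filter :: "'a set \<Rightarrow> 'a filter \<Rightarrow> bool" where
  "mem_filter A p \<longleftrightarrow> eventually (\<lambda>x. x \<in> A) p"

definition stone_cech :: "'a filter topology" where
  "stone_cech = topology_generated_by {{p. ultrafilter p \<and> mem_filter A p} | A. True}"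

text \<open>The points of the Stone--Cech compactification of the discrete space on a type are the
  ultrafilters. The point \<open>x\<close> is identified with the principal ultrafilter \<open>principal {x}\<close>. The extension is
  made unique by fixing its value outside the set of ultrafilters.\<close>

definition stone_ext :: "('a \<Rightarrow> bool) \<Rightarrow> 'a filter \<Rightarrow> bool" where
  "stone_ext f = (THE g. g \<in> extensional (Collect ultrafilter) \<and>
     continuous_map stone_cech (discrete_topology UNIV) g \<and> (\<forall>x. g (principal {x}) = f x))"

lemma ultrafilter_principal: "ultrafilter (principal {x})"
  by (auto simp: ultrafilter_def eventually_principal principal_eq_bot_iff)

lemma mem_filter_principal: "mem_filter A (principal {x}) \<longleftrightarrow> x \<in> A"
  by (auto simp: mem_filter_def eventually_principal)

lemma mem_filter_Int: "mem_filter (A \<inter> B) p \<longleftrightarrow> mem_filter A p \<and> mem_filter B p"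
  by (simp add: mem_filter_def eventually_conj_iff)

lemma mem_filter_mono: "mem_filter A p \<Longrightarrow> A \<subseteq> B \<Longrightarrow> mem_filter B p"
  unfolding mem_filter_def by (erule eventually_mono) auto

lemma ultrafilter_Compl:
  assumes "ultrafilter p"
  shows "mem_filter (- A) p \<longleftrightarrow> \<not> mem_filter A p"
proof -
  have "mem_filter A p \<or> mem_filter (- A) p"
    using assms by (simp add: ultrafilter_def mem_filter_def)
  moreover have "\<not> (mem_filter A p \<and> mem_filter (- A) p)"
    using assms unfolding mem_filter_Int [symmetric]
    by (simp add: ultrafilter_def mem_filter_def eventually_False)
  ultimately show ?thesis by blast
qed

lemma topspace_stone_cech [simp]: "topspace stone_cech = Collect ultrafilter"
proof -
  have "mem_filter UNIV p" for p :: "'a filter"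
    by (simp add: mem_filter_def)
  then show ?thesis
    unfolding stone_cech_def topology_generated_by_topspace by auto
qed

lemma openin_stone_cech:
  "openin stone_cech U \<longleftrightarrow> U \<subseteq> Collect ultrafilter \<and>
     (\<forall>p\<in>U. \<exists>A. mem_filter A p \<and> (\<forall>q. ultrafilter q \<and> mem_filter A q \<longrightarrow> q \<in> U))"
    (is "?L \<longleftrightarrow> ?R")
proof
  assume ?L
  then have "generate_topology_on {{p. ultrafilter p \<and> mem_filter A p} | A. True} U"
    unfolding stone_cech_def by (rule openin_topology_generated_by)
  then have "\<forall>p\<in>U. \<exists>A. mem_filter A p \<and> (\<forall>q. ultrafilter q \<and> mem_filter A q \<longrightarrow> q \<in> U)"
  proof induction
    case Empty
    then show ?case by simp
  next
    case (Int U V)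
    show ?case
    proof
      fix p assume "p \<in> U \<inter> V"
      then have "p \<in> U" "p \<in> V" by auto
      from bspec [OF Int.IH(1) this(1)] bspec [OF Int.IH(2) this(2)] obtain A B where
        "mem_filter A p" "\<forall>q. ultrafilter q \<and> mem_filter A q \<longrightarrow> q \<in> U"
        "mem_filter B p" "\<forall>q. ultrafilter q \<and> mem_filter B q \<longrightarrow> q \<in> V"
        by (elim exE conjE) rule
      then show "\<exists>A. mem_filter A p \<and> (\<forall>q. ultrafilter q \<and> mem_filter A q \<longrightarrow> q \<in> U \<inter> V)"
        by (intro exI [of _ "A \<inter> B"]) (simp add: mem_filter_Int)
    qed
  next
    case (UN K)
    show ?case
    proof
      fix p assume "p \<in> \<Union>K"
      then obtain U where "U \<in> K" "p \<in> U" by blast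
      from bspec [OF UN.IH [OF this(1)] this(2)] this(1)
      show "\<exists>A. mem_filter A p \<and> (\<forall>q. ultrafilter q \<and> mem_filter A q \<longrightarrow> q \<in> \<Union>K)"
        by blast
    qed
  next
    case (Basis S)
    then show ?case by auto
  qed
  moreover have "U \<subseteq> Collect ultrafilter"
    using openin_subset [OF \<open>?L\<close>] by simp
  ultimately show ?R by blast
next
  assume R: ?R
  show ?L
  proof (subst openin_subopen, intro ballI)
    fix p assume "p \<in> U"
    with R obtain A where "mem_filter A p" "\<forall>q. ultrafilter q \<and> mem_filter A q \<longrightarrow> q \<in> U"
      by blast
    moreover have "openin stone_cech {p. ultrafilter p \<and> mem_filter A p}"
      unfolding stone_cech_def by (rule topology_generated_by_Basis) auto
    ultimately show "\<exists>T. openin stone_cech T \<and> p \<in> T \<and> T \<subseteq> U"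
      using R \<open>p \<in> U\<close> by (intro exI [of _ "{p. ultrafilter p \<and> mem_filter A p}"]) auto
  qed
qed

lemma stone_ext_unique:
  assumes g: "continuous_map stone_cech (discrete_topology UNIV) g"
    and gf: "\<And>x. g (principal {x}) = f x" and p: "ultrafilter p"
  shows "g p \<longleftrightarrow> mem_filter {x. f x} p"
proof -
  have "mem_filter {x. f x = g p} p"
  proof -
    have "openin stone_cech {q \<in> topspace stone_cech. g q \<in> {g p}}"
      using g by (rule openin_continuous_map_preimage) simp
    moreover have "p \<in> {q \<in> topspace stone_cech. g q \<in> {g p}}"
      using p by simp
    ultimately obtain A where A: "mem_filter A p"
        "\<forall>q. ultrafilter q \<and> mem_filter A q \<longrightarrow> q \<in> {q \<in> topspace stone_cech. g q \<in> {g p}}"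
      unfolding openin_stone_cech by blast
    have "A \<subseteq> {x. f x = g p}"
    proof
      fix x assume "x \<in> A"
      then have "g (principal {x}) = g p"
        using A(2) [rule_format, of "principal {x}"]
        by (simp add: ultrafilter_principal mem_filter_principal)
      then show "x \<in> {x. f x = g p}" by (simp add: gf)
    qed
    with A(1) show ?thesis by (rule mem_filter_mono)
  qed
  then show ?thesis
    using ultrafilter_Compl [OF p, of "{x. f x}"] by (cases "g p") (auto simp: Compl_eq)
qed

lemma stone_ext_iff:
  assumes "ultrafilter p"
  shows "stone_ext f p \<longleftrightarrow> mem_filter {x. f x} p"
proof -
  define h where "h = (\<lambda>p\<in>Collect ultrafilter. mem_filter {x. f x} p)"
  have "openin stone_cech {p \<in> topspace stone_cech. h p \<in> U}" for U
    unfolding openin_stone_cech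
  proof (intro conjI ballI)
    fix p assume p: "p \<in> {p \<in> topspace stone_cech. h p \<in> U}"
    have "mem_filter {x. f x = h p} p"
      using p ultrafilter_Compl [of p "{x. f x}"]
      by (cases "h p") (auto simp: h_def Compl_eq)
    moreover have "h q = h p" if q: "ultrafilter q" "mem_filter {x. f x = h p} q" for q
    proof -
      have "h q \<longleftrightarrow> mem_filter {x. f x} q"
        using q(1) by (simp add: h_def)
      then show ?thesis
        using q ultrafilter_Compl [OF q(1), of "{x. f x}"]
        by (cases "h p") (auto simp only: Compl_eq mem_Collect_eq simp_thms)
    qed
    moreover have "q \<in> {p \<in> topspace stone_cech. h p \<in> U}" if "ultrafilter q" "h q = h p" for q
      using p that by simp
    ultimately show "\<exists>A. mem_filter A p \<and>
        (\<forall>q. ultrafilter q \<and> mem_filter A q \<longrightarrow> q \<in> {p \<in> topspace stone_cech. h p \<in> U})"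
      by blast
  qed auto
  then have cont: "continuous_map stone_cech (discrete_topology UNIV) h"
    by (simp add: continuous_map)
  have "stone_ext f = h"
    unfolding stone_ext_def
  proof (rule the_equality)
    show "h \<in> extensional (Collect ultrafilter) \<and>
        continuous_map stone_cech (discrete_topology UNIV) h \<and> (\<forall>x. h (principal {x}) = f x)"
      using cont by (simp add: h_def ultrafilter_principal mem_filter_principal)
  next
    fix g assume g: "g \<in> extensional (Collect ultrafilter) \<and>
        continuous_map stone_cech (discrete_topology UNIV) g \<and> (\<forall>x. g (principal {x}) = f x)"
    show "g = h"
    proof (rule extensionalityI)
      show "g \<in> extensional (Collect ultrafilter)" using g by blast
      show "h \<in> extensional (Collect ultrafilter)" by (simp add: h_def)
      show "g p = h p" if "p \<in> Collect ultrafilter" for p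
        using stone_ext_unique [of g f p] g that by (simp add: h_def)
    qed
  qed
  then show ?thesis using assms by (simp add: h_def)
qed

definition unbounded_ultrafilters :: "('a \<times> 'a) set set \<Rightarrow> 'a filter set" where
  "unbounded_ultrafilters \<E> =
     {p. ultrafilter p \<and> (\<forall>P. mem_filter P p \<longrightarrow> \<not> coarse_bounded \<E> P)}"

definition ends_rel :: "('a \<times> 'a) set set \<Rightarrow> ('a filter \<times> 'a filter) set" where
  "ends_rel \<E> = {(p, q) \<in> unbounded_ultrafilters \<E> \<times> unbounded_ultrafilters \<E>.
     \<forall>f. slowly_oscillating \<E> f \<longrightarrow> stone_ext f p = stone_ext f q}"

definition space_of_ends :: "('a \<times> 'a) set set \<Rightarrow> 'a filter set topology" where
  "space_of_ends \<E> = topology (\<lambda>\<U>. \<U> \<subseteq> unbounded_ultrafilters \<E> // ends_rel \<E> \<and>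
     openin (subtopology stone_cech (unbounded_ultrafilters \<E>)) (\<Union>\<U>))"

lemma equiv_ends_rel: "equiv (unbounded_ultrafilters \<E>) (ends_rel \<E>)"
  by (rule equivI) (auto simp: ends_rel_def refl_on_def sym_def trans_def)

lemma openin_space_of_ends:
  "openin (space_of_ends \<E>) \<U> \<longleftrightarrow> \<U> \<subseteq> unbounded_ultrafilters \<E> // ends_rel \<E> \<and>
     openin (subtopology stone_cech (unbounded_ultrafilters \<E>)) (\<Union>\<U>)"
proof -
  let ?Q = "unbounded_ultrafilters \<E> // ends_rel \<E>"
  let ?X = "subtopology stone_cech (unbounded_ultrafilters \<E>)"
  have "istopology (\<lambda>\<U>. \<U> \<subseteq> ?Q \<and> openin ?X (\<Union>\<U>))"
    unfolding istopology_def
  proof (intro conjI allI impI; (elim conjE)?)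
    fix \<U> \<V> assume U: "\<U> \<subseteq> ?Q" "openin ?X (\<Union>\<U>)" and V: "\<V> \<subseteq> ?Q" "openin ?X (\<Union>\<V>)"
    show "\<U> \<inter> \<V> \<subseteq> ?Q" using U(1) by (rule le_infI1)
    have "\<Union>(\<U> \<inter> \<V>) = \<Union>\<U> \<inter> \<Union>\<V>"
    proof (intro equalityI subsetI)
      fix p assume "p \<in> \<Union>\<U> \<inter> \<Union>\<V>"
      then obtain A B where AB: "A \<in> \<U>" "B \<in> \<V>" "p \<in> A" "p \<in> B" by blast
      then have "A = B"
        using quotient_disj [OF equiv_ends_rel, of A \<E> B] U(1) V(1) by blast
      then show "p \<in> \<Union>(\<U> \<inter> \<V>)" using AB by blast
    qed blast
    then show "openin ?X (\<Union>(\<U> \<inter> \<V>))" using U(2) V(2) by (simp only: openin_Int)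
  next
    fix \<K> assume K: "\<forall>\<U>\<in>\<K>. \<U> \<subseteq> ?Q \<and> openin ?X (\<Union>\<U>)"
    show "\<Union>\<K> \<subseteq> ?Q" using K by blast
    have "openin ?X (\<Union>(Union ` \<K>))"
      by (rule openin_Union) (use K in blast)
    moreover have "\<Union>(Union ` \<K>) = \<Union>(\<Union>\<K>)" by blast
    ultimately show "openin ?X (\<Union>(\<Union>\<K>))" by simp
  qed
  then show ?thesis
    unfolding space_of_ends_def by (simp add: topology_inverse')
qed

lemma topspace_space_of_ends:
  "topspace (space_of_ends \<E>) = unbounded_ultrafilters \<E> // ends_rel \<E>"
proof (rule antisym)
  show "topspace (space_of_ends \<E>) \<subseteq> unbounded_ultrafilters \<E> // ends_rel \<E>"
    using openin_space_of_ends openin_topspace by blast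
  have "\<Union>(unbounded_ultrafilters \<E> // ends_rel \<E>)
      = topspace (subtopology stone_cech (unbounded_ultrafilters \<E>))"
    unfolding Union_quotient [OF equiv_ends_rel]
    by (auto simp: unbounded_ultrafilters_def)
  then have "openin (space_of_ends \<E>) (unbounded_ultrafilters \<E> // ends_rel \<E>)"
    unfolding openin_space_of_ends by (metis order_refl openin_topspace)
  then show "unbounded_ultrafilters \<E> // ends_rel \<E> \<subseteq> topspace (space_of_ends \<E>)"
    by (rule openin_subset)
qed

definition group_topology :: "'a::ab_group_add topology \<Rightarrow> bool" where
  "group_topology T \<longleftrightarrow> topspace T = UNIV \<and>
     continuous_map (prod_topology T T) T (\<lambda>(x, y). x + y) \<and> continuous_map T T uminus"

definition T_sequence :: "(nat \<Rightarrow> 'a::ab_group_add) \<Rightarrow> bool" where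
  "T_sequence a \<longleftrightarrow> (\<exists>T. group_topology T \<and> Hausdorff_space T \<and> limitin T a 0 sequentially)"

definition trivial_sequence :: "(nat \<Rightarrow> 'a::zero) \<Rightarrow> bool" where
  "trivial_sequence a \<longleftrightarrow> finite {n. a n \<noteq> 0}"

definition is_strongest_topology :: "(nat \<Rightarrow> 'a::ab_group_add) \<Rightarrow> 'a topology \<Rightarrow> bool" where
  "is_strongest_topology a T \<longleftrightarrow> group_topology T \<and> limitin T a 0 sequentially \<and>
     (\<forall>T'. group_topology T' \<and> limitin T' a 0 sequentially \<longrightarrow> (\<forall>U. openin T' U \<longrightarrow> openin T U))"

definition strongest_topology :: "(nat \<Rightarrow> 'a::ab_group_add) \<Rightarrow> 'a topology" where
  "strongest_topology a = (THE T. is_strongest_topology a T)"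

text \<open>Precompact is taken as having compact closure; in a complete group this agrees with
  total boundedness.\<close>

definition precompact_sets :: "'a topology \<Rightarrow> 'a set set" where
  "precompact_sets T = {A. A \<subseteq> topspace T \<and> compactin T (T closure_of A)}"

definition precompact_ideal :: "(nat \<Rightarrow> 'a::ab_group_add) \<Rightarrow> 'a set set" where
  "precompact_ideal a = precompact_sets (strongest_topology a)"

definition group_entourages :: "'a::ab_group_add set set \<Rightarrow> ('a \<times> 'a) set set" where
  "group_entourages \<I> = {{(x, y). x - y \<in> P} | P. P \<in> \<I> \<and> 0 \<in> P}"

definition coarse_group :: "'a::ab_group_add set set \<Rightarrow> ('a \<times> 'a) set set" where
  "coarse_group \<I> = {E. Id \<subseteq> E \<and> (\<exists>B\<in>group_entourages \<I>. E \<subseteq> B)}"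

lemma is_strongest_topology_ex:
  assumes "T_sequence a"
  shows "\<exists>T. is_strongest_topology a T"
proof -
  define \<T> where "\<T> = {T. group_topology T \<and> limitin T a 0 sequentially}"
  define S where "S = topology_generated_by {U. \<exists>T\<in>\<T>. openin T U}"
  obtain T0 where "T0 \<in> \<T>"
    using assms by (auto simp: \<T>_def T_sequence_def)
  have fine: "openin S U" if "T \<in> \<T>" "openin T U" for T U
    unfolding S_def using that by (intro topology_generated_by_Basis) blast
  have tops: "topspace T = UNIV" if "T \<in> \<T>" for T
    using that by (simp add: \<T>_def group_topology_def)
  have topS: "topspace S = UNIV"
    using fine [OF \<open>T0 \<in> \<T>\<close>, of UNIV] tops [OF \<open>T0 \<in> \<T>\<close>]
    by (metis openin_subset openin_topspace top.extremum_uniqueI)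
  have id: "continuous_map S T id" if "T \<in> \<T>" for T
    using fine [OF that] tops [OF that] topS by (simp add: continuous_map)
  have union: "\<Union>{U. \<exists>T\<in>\<T>. openin T U} = UNIV"
    using topS unfolding S_def by simp
  have contI: "continuous_map X S f"
    if "\<And>T U. T \<in> \<T> \<Longrightarrow> openin T U \<Longrightarrow> openin X (f -` U \<inter> topspace X)"
    for X f
    unfolding S_def
    by (rule continuous_on_generated_topo) (use that union in auto)
  have "continuous_map (prod_topology S S) S (\<lambda>(x, y). x + y)"
  proof (rule contI)
    show "openin (prod_topology S S) ((\<lambda>(x, y). x + y) -` U \<inter> topspace (prod_topology S S))"
      if "T \<in> \<T>" "openin T U" for T U
    proof -
      have "continuous_map (prod_topology S S) (prod_topology T T) (\<lambda>(x, y). (id x, id y))"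
        using id [OF that(1)] by (simp only: continuous_map_prod_top simp_thms)
      moreover have "continuous_map (prod_topology T T) T (\<lambda>(x, y). x + y)"
        using that(1) by (simp add: \<T>_def group_topology_def)
      ultimately have "continuous_map (prod_topology S S) T
          ((\<lambda>(x, y). x + y) \<circ> (\<lambda>(x, y). (id x, id y)))"
        by (rule continuous_map_compose)
      then have "continuous_map (prod_topology S S) T (\<lambda>(x, y). x + y)"
        by (simp only: comp_def id_def case_prod_unfold fst_conv snd_conv)
      then show ?thesis
        using that(2) unfolding continuous_map_alt by blast
    qed
  qed
  moreover have "continuous_map S S uminus"
  proof (rule contI)
    show "openin S (uminus -` U \<inter> topspace S)" if "T \<in> \<T>" "openin T U" for T U
    proof -
      have "continuous_map T T uminus"
        using that(1) by (simp add: \<T>_def group_topology_def)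
      then have "continuous_map S T uminus"
        using continuous_map_compose [OF id [OF that(1)]] by (metis comp_id)
      then show ?thesis
        using that(2) unfolding continuous_map_alt by blast
    qed
  qed
  moreover have "limitin S a 0 sequentially"
  proof -
    have "0 \<in> U \<longrightarrow> eventually (\<lambda>n. a n \<in> U) sequentially"
      if "generate_topology_on {U. \<exists>T\<in>\<T>. openin T U} U" for U
      using that
    proof induction
      case (Int U V)
      then show ?case by (auto simp: eventually_conj_iff)
    next
      case (UN K)
      show ?case
      proof
        assume "0 \<in> \<Union>K"
        then obtain U where U: "U \<in> K" "0 \<in> U" by blast
        with UN have "eventually (\<lambda>n. a n \<in> U) sequentially" by blast
        then show "eventually (\<lambda>n. a n \<in> \<Union>K) sequentially"
          by (rule eventually_mono) (use U in blast)
      qed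
    qed (auto simp: \<T>_def limitin_def)
    then show ?thesis
      unfolding limitin_def topS unfolding S_def
      using openin_topology_generated_by by blast
  qed
  ultimately have "is_strongest_topology a S"
    unfolding is_strongest_topology_def group_topology_def [of S]
    using topS fine by (auto simp: \<T>_def)
  then show ?thesis ..
qed

lemma is_strongest_topology_unique:
  "is_strongest_topology a T \<Longrightarrow> is_strongest_topology a T' \<Longrightarrow> T = T'"
  unfolding is_strongest_topology_def topology_eq by blast

lemma strongest_topology:
  assumes "T_sequence a"
  shows "is_strongest_topology a (strongest_topology a)"
  unfolding strongest_topology_def
  by (metis (no_types) is_strongest_topology_ex [OF assms] is_strongest_topology_unique the_equality)

lemma Hausdorff_strongest_topology:
  assumes "T_sequence a"
  shows "Hausdorff_space (strongest_topology a)"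
proof -
  from assms obtain T where T: "group_topology T" "Hausdorff_space T" "limitin T a 0 sequentially"
    by (auto simp: T_sequence_def)
  have "openin (strongest_topology a) U" if "openin T U" for U
    using strongest_topology [OF assms] T that by (auto simp: is_strongest_topology_def)
  moreover have "topspace (strongest_topology a) = topspace T"
    using strongest_topology [OF assms] T(1)
    by (simp add: is_strongest_topology_def group_topology_def)
  ultimately show ?thesis
    using T(2) unfolding Hausdorff_space_def by metis
qed

lemma coarse_base_coarse_group: "coarse_base (group_entourages \<I>) (coarse_group \<I>)"
  by (auto simp: coarse_base_def coarse_group_def group_entourages_def)

lemma coarse_structure_coarse_group:
  assumes "T_sequence a"
  shows "coarse_structure (coarse_group (precompact_ideal a))"
proof -
  let ?T = "strongest_topology a" and ?I = "precompact_ideal a"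
  have T: "group_topology ?T"
    using strongest_topology [OF assms] by (simp add: is_strongest_topology_def)
  then have top: "topspace ?T = UNIV"
    by (simp add: group_topology_def)
  have I: "A \<in> ?I" if "compactin ?T K" "A \<subseteq> K" for A K
  proof -
    have "closedin ?T K"
      using compactin_imp_closedin Hausdorff_strongest_topology [OF assms] that(1) by blast
    then have "?T closure_of A \<subseteq> K"
      using that(2) by (simp add: closure_of_minimal)
    then have "compactin ?T (?T closure_of A)"
      using that(1) by (metis closed_compactin closedin_closure_of)
    then show ?thesis
      by (simp add: precompact_ideal_def precompact_sets_def top)
  qed
  have cl: "compactin ?T (?T closure_of A)" "A \<subseteq> ?T closure_of A" if "A \<in> ?I" for A
    using that by (auto simp: precompact_ideal_def precompact_sets_def closure_of_subset)
  have plus: "(\<lambda>(x, y). x + y) ` (A \<times> B) \<in> ?I" if "A \<in> ?I" "B \<in> ?I" for A B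
  proof (rule I)
    show "compactin ?T ((\<lambda>(x, y). x + y) ` ((?T closure_of A) \<times> (?T closure_of B)))"
      using T cl [OF that(1)] cl [OF that(2)]
      by (intro image_compactin [where X = "prod_topology ?T ?T"])
        (auto simp: compactin_Times group_topology_def)
  qed (use cl that in fast)
  have uminus: "uminus ` A \<in> ?I" if "A \<in> ?I" for A
  proof (rule I)
    show "compactin ?T (uminus ` (?T closure_of A))"
      using T cl [OF that] by (intro image_compactin) (auto simp: group_topology_def)
  qed (use cl that in fast)
  have mem: "E \<in> coarse_group ?I" if "Id \<subseteq> E" "P \<in> ?I" "\<And>x y. (x, y) \<in> E \<Longrightarrow> x - y \<in> P" for E P
  proof -
    have "0 \<in> P" using that(1) that(3) [of 0 0] by auto
    then show ?thesis
      using that by (auto simp: coarse_group_def group_entourages_def)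
  qed
  have ex: "Id \<subseteq> E \<and> (\<exists>P\<in>?I. \<forall>x y. (x, y) \<in> E \<longrightarrow> x - y \<in> P)" if "E \<in> coarse_group ?I" for E
    using that by (auto simp: coarse_group_def group_entourages_def)
  show ?thesis
    unfolding coarse_structure_def
  proof (intro conjI ballI allI impI)
    fix E assume E: "E \<in> coarse_group ?I"
    then obtain P where P: "P \<in> ?I" "\<And>x y. (x, y) \<in> E \<Longrightarrow> x - y \<in> P"
      using ex by meson
    show Id: "Id \<subseteq> E" using ex E by blast
    show "E\<inverse> \<in> coarse_group ?I"
    proof (rule mem [OF _ uminus [OF P(1)]])
      show "x - y \<in> uminus ` P" if "(x, y) \<in> E\<inverse>" for x y
        using P(2) [of y x] that by (metis converse_iff image_eqI minus_diff_eq)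
    qed (use Id in blast)
    show "E' \<in> coarse_group ?I" if "Id \<subseteq> E' \<and> E' \<subseteq> E" for E'
      using that P by (intro mem [of E' P]) auto
    fix E' assume E': "E' \<in> coarse_group ?I"
    then obtain P' where P': "P' \<in> ?I" "\<And>x y. (x, y) \<in> E' \<Longrightarrow> x - y \<in> P'"
      using ex by meson
    show "E O E' \<in> coarse_group ?I"
    proof (rule mem [OF _ plus [OF P(1) P'(1)]])
      show "Id \<subseteq> E O E'" using Id ex [OF E'] by blast
      show "x - y \<in> (\<lambda>(x, y). x + y) ` (P \<times> P')" if "(x, y) \<in> E O E'" for x y
      proof -
        from that obtain z where z: "(x, z) \<in> E" "(z, y) \<in> E'" by blast
        have "x - y = (x - z) + (z - y)" by simp
        with P(2) [OF z(1)] P'(2) [OF z(2)] show ?thesis by force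
      qed
    qed
  next
    fix x y :: 'a
    have "{0, x - y} \<in> ?I"
      by (rule I [of "{0, x - y}"]) (auto simp: top finite_imp_compactin)
    then have "insert (x, y) Id \<in> coarse_group ?I"
      by (intro mem [of _ "{0, x - y}"]) auto
    then show "\<exists>E\<in>coarse_group ?I. (x, y) \<in> E" by blast
  qed
qed

end

theory Submission
  imports Defs
begin

text \<open>Let \<open>f\<close> be slowly oscillating and let \<open>K\<close> be a compact set outside of which \<open>f\<close> does not change
  when \<open>a\<^sub>n\<close> is added. Given \<open>x, y \<notin> K\<close>, let \<open>Z\<close> be the set of all \<open>z\<close> with \<open>x + z, y + z \<notin> K\<close>,
  \<open>f (x + z) = f x\<close> and \<open>f (y + z) = f y\<close>. Since \<open>K\<close> is closed and \<open>a\<^sub>n \<rightarrow> 0\<close>, for \<open>z \<in> Z\<close> almost all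
  \<open>z + a\<^sub>n\<close> are again in \<open>Z\<close>, so \<open>Z\<close> is nonempty and has no isolated points. As \<open>G\<close> is countable,
  such a set is not contained in a compact set. On the other hand, writing \<open>y - x\<close> in terms of the
  generators gives a path from \<open>x\<close> to \<open>y\<close>, and some \<open>z \<in> Z\<close> translates this finite path off \<open>K\<close>.
  Hence \<open>f x = f (x + z) = f (y + z) = f y\<close>.\<close>

section \<open>Existence of ultrafilters\<close>

text \<open>Zorn's lemma for the reversed order yields a minimal proper filter. Minimality decides
  every predicate \<open>P\<close>: either restricting to \<open>P\<close> gives \<open>bot\<close>,
  so the negation holds eventually, or it changes nothing, so \<open>P\<close> does.\<close>

lemma ultrafilter_below:
  fixes F :: "'a filter"
  assumes "F \<noteq> bot"
  obtains p where "p \<le> F" "ultrafilter p"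
proof -
  define A where "A = {F'. F' \<noteq> bot \<and> F' \<le> F}"
  have "\<exists>m\<in>A. \<forall>F'\<in>A. F' \<le> m \<longrightarrow> F' = m"
  proof (rule predicate_Zorn)
    show "partial_order_on A (relation_of (\<lambda>F F'. F' \<le> F) A)"
      by (rule partial_order_on_relation_ofI) auto
  next
    fix C assume C: "C \<in> Chains (relation_of (\<lambda>F F'. F' \<le> F) A)"
    then have CA: "C \<subseteq> A"
      using Chains_relation_of by blast
    have chain: "F1 \<le> F2 \<or> F2 \<le> F1" if "F1 \<in> C" "F2 \<in> C" for F1 F2
      using C that by (auto simp: Chains_def relation_of_def)
    \<comment> \<open>\<open>F\<close> is added to the chain so that the infimum stays below
      \<open>F\<close> even when \<open>C\<close> is empty.\<close>
    have least: "\<exists>m\<in>insert F C. \<forall>F'\<in>X. m \<le> F'" if "finite X" "X \<subseteq> insert F C" for X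
      using that
    proof (induction X)
      case (insert F1 X)
      then obtain m where "m \<in> insert F C" "\<forall>F'\<in>X. m \<le> F'" by auto
      moreover from this insert.prems have "m \<le> F1 \<or> F1 \<le> m"
        using chain CA by (auto simp: A_def)
      ultimately show ?case
        using insert.prems by (metis insert_iff insert_subset order_trans order_refl)
    qed auto
    have "Inf (insert F C) \<noteq> bot"
    proof (rule Inf_filter_not_bot)
      fix X assume "X \<subseteq> insert F C" "finite X"
      with least obtain m where m: "m \<in> insert F C" "\<forall>F'\<in>X. m \<le> F'" by blast
      then have "m \<le> Inf X" by (simp add: Inf_greatest)
      moreover have "m \<noteq> bot" using m(1) CA assms by (auto simp: A_def)
      ultimately show "Inf X \<noteq> bot" by (metis bot.extremum_uniqueI)
    qed
    then have "Inf (insert F C) \<in> A"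
      by (simp add: A_def)
    moreover have "\<forall>F'\<in>C. Inf (insert F C) \<le> F'"
      by (simp add: Inf_lower le_infI2)
    ultimately show "\<exists>u\<in>A. \<forall>F'\<in>C. u \<le> F'" by blast
  qed
  then obtain p where p: "p \<noteq> bot" "p \<le> F"
    and min: "\<And>F'. F' \<noteq> bot \<Longrightarrow> F' \<le> p \<Longrightarrow> F' = p"
    unfolding A_def by (auto intro: order_trans)
  have "eventually P p \<or> eventually (\<lambda>x. \<not> P x) p" for P
  proof (cases "inf p (principal {x. P x}) = bot")
    case True
    then show ?thesis
      by (simp add: trivial_limit_def eventually_inf_principal)
  next
    case False
    then have "inf p (principal {x. P x}) = p" by (intro min) auto
    then have "p \<le> principal {x. P x}" by (simp add: inf.orderI)
    then show ?thesis by (simp add: le_principal)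
  qed
  with p show thesis
    by (intro that [of p]) (auto simp: ultrafilter_def)
qed

section \<open>Countably generated groups and perfect sets\<close>

text \<open>Group elements are sums of lists over generators and their negatives, and there are only
  countably many such lists.\<close>

lemma countable_group_closure:
  fixes S :: "'a::ab_group_add set"
  assumes "countable S"
  shows "countable (group_closure S)"
proof -
  let ?L = "lists (S \<union> uminus ` S)"
  have "group_closure S \<subseteq> sum_list ` ?L"
  proof
    fix g assume "g \<in> group_closure S"
    then show "g \<in> sum_list ` ?L"
    proof induction
      case (base s)
      then show ?case
        by (auto intro: image_eqI [where x = "[]"] image_eqI [where x = "[s]"])
    next
      case (diff s t)
      then obtain xs ys where xs: "xs \<in> ?L" "s = sum_list xs" and ys: "ys \<in> ?L" "t = sum_list ys"
        by blast
      have "map uminus ys \<in> ?L"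
        using ys(1) by force
      with xs ys(2) show ?case
        using uminus_sum_list_map [of "\<lambda>x. x" ys]
        by (intro image_eqI [where x = "xs @ map uminus ys"]) (simp_all add: comp_def)
    qed
  qed
  moreover have "countable (sum_list ` ?L)"
    using assms by (intro countable_image countable_lists) auto
  ultimately show ?thesis by (rule countable_subset)
qed

text \<open>The closure of \<open>Z\<close> is a nonempty perfect set and, being closed in
  \<open>K\<close>, is compact Hausdorff. Such a space has at least the cardinality of the
  continuum.\<close>

lemma uncountable_compact_superset_of_dense_in_itself:
  assumes T: "Hausdorff_space T" and K: "compactin T K"
    and Z: "Z \<subseteq> K" "Z \<noteq> {}" "Z \<subseteq> T derived_set_of Z"
  shows "uncountable K"
proof -
  define C where "C = T closure_of Z"
  have "closedin T K"
    using T K by (rule compactin_imp_closedin)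
  then have CK: "C \<subseteq> K"
    unfolding C_def using Z(1) by (intro closure_of_minimal)
  have ZC: "Z \<subseteq> C"
    unfolding C_def using Z(1) compactin_subset_topspace [OF K] by (intro closure_of_subset) auto
  have clC: "closedin T C"
    by (simp add: C_def)
  have "C \<subseteq> T derived_set_of Z"
    unfolding C_def closure_of using Z(3) by blast
  then have "C \<subseteq> T derived_set_of C"
    using derived_set_of_mono [OF ZC] by blast
  moreover have "T derived_set_of C \<subseteq> C"
    using clC by (simp add: closedin_contains_derived_set)
  ultimately have "subtopology T C derived_set_of C = C"
    by (auto simp: derived_set_of_subtopology)
  moreover have "locally_compact_space (subtopology T C)"
    using closed_compactin [OF K CK clC]
    by (intro compact_imp_locally_compact_space compact_space_subtopology)
  ultimately have "(UNIV :: real set) \<lesssim> C"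
    using ZC Z(2) Hausdorff_space_subtopology [OF T] by (intro lepoll_perfect_set) auto
  then have "uncountable C"
    using countable_lepoll uncountable_UNIV_real by blast
  then show ?thesis
    using CK countable_subset by blast
qed

section \<open>Translations and the convergent sequence\<close>

lemma continuous_map_add_left:
  fixes T :: "'a::ab_group_add topology"
  assumes "group_topology T"
  shows "continuous_map T T ((+) c)"
proof -
  have "continuous_map T (prod_topology T T) (\<lambda>x. (c, x))"
    using assms by (auto simp: continuous_map_pairwise comp_def group_topology_def)
  then have "continuous_map T T ((\<lambda>(x, y). x + y) \<circ> (\<lambda>x. (c, x)))"
    using assms unfolding group_topology_def by (meson continuous_map_compose)
  then show ?thesis
    by (simp add: comp_def)
qed

lemma continuous_map_diff_left:
  fixes T :: "'a::ab_group_add topology"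
  assumes "group_topology T"
  shows "continuous_map T T (\<lambda>x. c - x)"
proof -
  have "continuous_map T T ((+) c \<circ> uminus)"
    using continuous_map_add_left [OF assms] assms
    unfolding group_topology_def by (meson continuous_map_compose)
  then show ?thesis
    by (simp add: comp_def)
qed

lemma eventually_add_in_open:
  fixes T :: "'a::ab_group_add topology"
  assumes "group_topology T" "limitin T a 0 sequentially" "openin T U" "g \<in> U"
  shows "\<forall>\<^sub>F n in sequentially. g + a n \<in> U"
proof -
  have "limitin T ((+) g \<circ> a) (g + 0) sequentially"
    using continuous_map_add_left [OF assms(1)] assms(2) by (rule continuous_map_limit)
  then show ?thesis
    using assms(3,4) by (simp add: limitin_def)
qed

text \<open>Since \<open>a n\<close> is nonzero infinitely often, each \<open>z\<close> in
  \<open>Z\<close> is an accumulation point of the points \<open>z + a n\<close> lying in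
  \<open>Z\<close>. A compact set around \<open>Z\<close> would then be uncountable.\<close>

lemma add_closed_set_not_in_compact:
  fixes T :: "'a::ab_group_add topology"
  assumes T: "group_topology T" "Hausdorff_space T" and lim: "limitin T a 0 sequentially"
    and a: "\<not> trivial_sequence a" and countable: "countable (UNIV :: 'a set)"
    and Z: "z0 \<in> Z" "\<And>z. z \<in> Z \<Longrightarrow> \<forall>\<^sub>F n in sequentially. z + a n \<in> Z" and K: "compactin T K"
  shows "\<not> Z \<subseteq> K"
proof
  assume "Z \<subseteq> K"
  have "Z \<subseteq> T derived_set_of Z"
  proof
    fix z assume z: "z \<in> Z"
    have "\<exists>y. y \<noteq> z \<and> y \<in> Z \<and> y \<in> U" if U: "z \<in> U" "openin T U" for U
    proof -
      have "\<exists>\<^sub>F n in sequentially. a n \<noteq> 0"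
        using a by (simp add: trivial_sequence_def frequently_cofinite flip: cofinite_eq_sequentially)
      then have "\<exists>\<^sub>F n in sequentially. (z + a n \<in> Z \<and> z + a n \<in> U) \<and> a n \<noteq> 0"
        using Z(2) [OF z] eventually_add_in_open [OF T(1) lim U(2,1)]
        by (intro frequently_eventually_conj eventually_conj)
      then obtain n where "z + a n \<in> Z" "z + a n \<in> U" "a n \<noteq> 0"
        using frequently_ex by blast
      then show ?thesis
        by (intro exI [of _ "z + a n"]) simp
    qed
    then show "z \<in> T derived_set_of Z"
      using T(1) by (auto simp: in_derived_set_of group_topology_def)
  qed
  then have "uncountable K"
    using Z(1) \<open>Z \<subseteq> K\<close> by (intro uncountable_compact_superset_of_dense_in_itself [OF T(2) K]) auto
  moreover have "countable K"
    using countable by (rule countable_subset [rotated]) simp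
  ultimately show False by simp
qed

section \<open>Functions invariant under the generators outside a compact set\<close>

text \<open>\<open>W\<close> holds the offsets at which a path from \<open>v\<close> to
  \<open>v + d\<close> must avoid \<open>K\<close>. It is chosen before \<open>v\<close>, so one
  finite set serves all translates of the path.\<close>

lemma finite_path_group_closure:
  fixes S :: "'a::ab_group_add set"
  assumes f: "\<And>x s. x \<notin> K \<Longrightarrow> s \<in> S \<Longrightarrow> f (x + s) = f x" and d: "d \<in> group_closure S"
  shows "\<exists>W. finite W \<and> (\<forall>v. (\<forall>w\<in>W. w + v \<notin> K) \<longrightarrow> f (v + d) = f v)"
  using d
proof induction
  case (base s)
  then show ?case
    using f by (intro exI [of _ "{0}"]) auto
next
  case (diff s t)
  then obtain W W' where W: "finite W" "\<And>v. (\<forall>w\<in>W. w + v \<notin> K) \<Longrightarrow> f (v + s) = f v"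
    and W': "finite W'" "\<And>v. (\<forall>w\<in>W'. w + v \<notin> K) \<Longrightarrow> f (v + t) = f v"
    by blast
  show ?case
  proof (intro exI conjI allI impI)
    \<comment> \<open>The path first follows \<open>s\<close>, then runs the path for
      \<open>t\<close> backwards. The latter path starts at \<open>v + (s - t)\<close>, which shifts
      its offsets by \<open>s - t\<close>.\<close>
    show "finite (W \<union> (\<lambda>w. w + (s - t)) ` W')"
      using W(1) W'(1) by simp
    fix v assume v: "\<forall>w\<in>W \<union> (\<lambda>w. w + (s - t)) ` W'. w + v \<notin> K"
    have "f (v + (s - t)) = f (v + (s - t) + t)"
      using v by (intro W'(2) [symmetric]) (simp add: ball_Un ac_simps)
    also have "\<dots> = f v"
      using v W(2) [of v] by (auto simp: algebra_simps)
    finally show "f (v + (s - t)) = f v" .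
  qed
qed

lemma constant_outside_compact:
  fixes T :: "'a::ab_group_add topology"
  assumes T: "group_topology T" "Hausdorff_space T" and lim: "limitin T a 0 sequentially"
    and a: "\<not> trivial_sequence a" and gen: "group_closure (range a) = UNIV"
    and K: "compactin T K" and f: "\<And>x n. x \<notin> K \<Longrightarrow> f (x + a n) = f x"
    and xy: "x \<notin> K" "y \<notin> K"
  shows "f x = f y"
proof -
  define Z where "Z = {z. x + z \<notin> K \<and> y + z \<notin> K \<and> f (x + z) = f x \<and> f (y + z) = f y}"
  obtain W where W: "finite W" "\<And>v. (\<forall>w\<in>W. w + v \<notin> K) \<Longrightarrow> f (v + (y - x)) = f v"
    using finite_path_group_closure [where f = f and K = K and S = "range a" and d = "y - x"] f gen
    by blast
  have "countable (UNIV :: 'a set)"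
    using countable_group_closure [of "range a"] gen by simp
  moreover have "0 \<in> Z"
    using xy by (simp add: Z_def)
  moreover have "\<forall>\<^sub>F n in sequentially. z + a n \<in> Z" if "z \<in> Z" for z
  proof -
    have "openin T (- K)"
      using compactin_imp_closedin [OF T(2) K] T(1)
      by (simp add: closedin_def group_topology_def Compl_eq_Diff_UNIV)
    then have "\<forall>\<^sub>F n in sequentially. (x + z) + a n \<in> - K \<and> (y + z) + a n \<in> - K"
      using that
      by (intro eventually_conj eventually_add_in_open [OF T(1) lim]) (auto simp: Z_def)
    then show ?thesis
    proof (rule eventually_mono)
      fix n assume "(x + z) + a n \<in> - K \<and> (y + z) + a n \<in> - K"
      then show "z + a n \<in> Z"
        using that f [of "x + z" n] f [of "y + z" n] by (simp add: Z_def add.assoc)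
    qed
  qed
  \<comment> \<open>This finite union of translates of \<open>K\<close> consists of the bad
    \<open>z\<close>, those for which \<open>w + (x + z)\<close> lies in \<open>K\<close> for some
    \<open>w\<close> in \<open>W\<close>.\<close>
  moreover have "compactin T (\<Union>w\<in>W. (\<lambda>k. - (w + x) + k) ` K)"
    using W(1) K continuous_map_add_left [OF T(1)]
    by (intro compactin_Union) (auto intro: image_compactin)
  ultimately have "\<not> Z \<subseteq> (\<Union>w\<in>W. (\<lambda>k. - (w + x) + k) ` K)"
    by (rule add_closed_set_not_in_compact [OF T lim a])
  then obtain z where z: "z \<in> Z" "z \<notin> (\<Union>w\<in>W. (\<lambda>k. - (w + x) + k) ` K)"
    by blast
  have "w + (x + z) \<notin> K" if "w \<in> W" for w
  proof
    assume "w + (x + z) \<in> K"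
    moreover have "z = - (w + x) + (w + (x + z))" by (simp add: algebra_simps)
    ultimately show False using z(2) that by blast
  qed
  then have "f (x + z + (y - x)) = f (x + z)"
    by (intro W(2)) auto
  moreover have "x + z + (y - x) = y + z" by simp
  ultimately show ?thesis
    using z(1) unfolding Z_def by (metis (mono_tags, lifting) mem_Collect_eq)
qed

section \<open>Bounded sets of the coarse group\<close>

lemma precompact_ideal_iff:
  assumes "T_sequence a"
  shows "P \<in> precompact_ideal a \<longleftrightarrow> (\<exists>K. compactin (strongest_topology a) K \<and> P \<subseteq> K)"
proof -
  let ?T = "strongest_topology a"
  have top: "topspace ?T = UNIV"
    using strongest_topology [OF assms] by (simp add: is_strongest_topology_def group_topology_def)
  show ?thesis
  proof
    assume "P \<in> precompact_ideal a"
    then show "\<exists>K. compactin ?T K \<and> P \<subseteq> K"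
      unfolding precompact_ideal_def precompact_sets_def using closure_of_subset by blast
  next
    assume "\<exists>K. compactin ?T K \<and> P \<subseteq> K"
    then obtain K where K: "compactin ?T K" "P \<subseteq> K" by blast
    then have "?T closure_of P \<subseteq> K"
      using compactin_imp_closedin [OF Hausdorff_strongest_topology [OF assms]]
      by (intro closure_of_minimal) auto
    then have "compactin ?T (?T closure_of P)"
      using K(1) by (meson closed_compactin closedin_closure_of)
    then show "P \<in> precompact_ideal a"
      by (simp add: precompact_ideal_def precompact_sets_def top)
  qed
qed

lemma group_entourage_in_coarse_group:
  assumes "P \<in> \<I>" "0 \<in> P"
  shows "{(x, y). x - y \<in> P} \<in> coarse_group \<I>"
proof -
  have "{(x, y). x - y \<in> P} \<in> group_entourages \<I>"
    unfolding group_entourages_def by (rule CollectI, rule exI [of _ P]) (use assms in simp)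
  moreover have "Id \<subseteq> {(x, y). x - y \<in> P}"
    using assms(2) by auto
  ultimately show ?thesis
    unfolding coarse_group_def by blast
qed

text \<open>The ball at \<open>x\<close> of the entourage given by \<open>P\<close> is
  \<open>x - P\<close>, and reflections and translations preserve compactness.\<close>

lemma coarse_bounded_coarse_group_iff:
  assumes "T_sequence a"
  shows "coarse_bounded (coarse_group (precompact_ideal a)) B \<longleftrightarrow>
    (\<exists>K. compactin (strongest_topology a) K \<and> B \<subseteq> K)"
proof -
  let ?T = "strongest_topology a"
  have T: "group_topology ?T"
    using strongest_topology [OF assms] by (simp add: is_strongest_topology_def)
  show ?thesis
  proof
    assume "coarse_bounded (coarse_group (precompact_ideal a)) B"
    then obtain x E P where "B \<subseteq> E `` {x}" "E \<subseteq> {(x, y). x - y \<in> P}"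
      and P: "P \<in> precompact_ideal a"
      by (auto simp: coarse_bounded_def coarse_group_def group_entourages_def)
    then have BP: "x - y \<in> P" if "y \<in> B" for y
      using that by auto
    obtain K where K: "compactin ?T K" "P \<subseteq> K"
      using P precompact_ideal_iff [OF assms] by blast
    have "y = x - (x - y)" for y by simp
    then have "B \<subseteq> (\<lambda>k. x - k) ` K"
      using BP K(2) by blast
    moreover have "compactin ?T ((\<lambda>k. x - k) ` K)"
      using K(1) continuous_map_diff_left [OF T] by (rule image_compactin)
    ultimately show "\<exists>K. compactin ?T K \<and> B \<subseteq> K" by blast
  next
    assume "\<exists>K. compactin ?T K \<and> B \<subseteq> K"
    then obtain K where K: "compactin ?T K" "B \<subseteq> K" by blast
    \<comment> \<open>The ball at \<open>0\<close> is \<open>- P\<close>, hence the reflection of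
      \<open>K\<close>. The point \<open>0\<close> is inserted so that the entourage contains the
      diagonal.\<close>
    define P where "P = insert 0 ((\<lambda>k. 0 - k) ` K)"
    have "compactin ?T ({0} \<union> (\<lambda>k. 0 - k) ` K)"
      using K(1) continuous_map_diff_left [OF T] T
      by (intro compactin_Un image_compactin [of ?T]) (auto simp: group_topology_def)
    then have "P \<in> precompact_ideal a"
      unfolding precompact_ideal_iff [OF assms] by (auto simp: P_def)
    then have "{(x, y). x - y \<in> P} \<in> coarse_group (precompact_ideal a)"
      by (rule group_entourage_in_coarse_group) (simp add: P_def)
    moreover have "B \<subseteq> {(x, y). x - y \<in> P} `` {0}"
      using K(2) by (auto simp: P_def)
    ultimately show "coarse_bounded (coarse_group (precompact_ideal a)) B"
      unfolding coarse_bounded_def by blast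
  qed
qed

text \<open>The whole group is trivially closed under adding terms of \<open>a\<close>, so
  \<open>add_closed_set_not_in_compact\<close> applies with \<open>Z = UNIV\<close>.\<close>

lemma not_coarse_bounded_UNIV:
  assumes a: "T_sequence a" "\<not> trivial_sequence a" "group_closure (range a) = UNIV"
  shows "\<not> coarse_bounded (coarse_group (precompact_ideal a)) UNIV"
proof -
  have "countable (group_closure (range a))"
    by (simp add: countable_group_closure)
  then have "\<not> UNIV \<subseteq> K" if "compactin (strongest_topology a) K" for K
    using add_closed_set_not_in_compact [of "strongest_topology a" a 0 UNIV K] that
      Hausdorff_strongest_topology [OF a(1)] strongest_topology [OF a(1)] a(2,3)
    by (simp add: is_strongest_topology_def)
  then show ?thesis
    by (auto simp: coarse_bounded_coarse_group_iff [OF a(1)])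
qed

section \<open>Ends of the coarse group\<close>

text \<open>Complements of bounded sets generate a proper filter, because the group is unbounded. An
  ultrafilter below it contains no bounded set.\<close>

lemma unbounded_ultrafilters_nonempty:
  assumes a: "T_sequence a" "\<not> trivial_sequence a" "group_closure (range a) = UNIV"
  shows "unbounded_ultrafilters (coarse_group (precompact_ideal a)) \<noteq> {}"
proof -
  let ?E = "coarse_group (precompact_ideal a)"
  let ?F = "INF B\<in>{B. coarse_bounded ?E B}. principal (- B)"
  have union: "coarse_bounded ?E (B \<union> B')" if "coarse_bounded ?E B" "coarse_bounded ?E B'" for B B'
    using that unfolding coarse_bounded_coarse_group_iff [OF a(1)]
    by (meson Un_mono compactin_Un)
  have empty: "coarse_bounded ?E {}"
    unfolding coarse_bounded_coarse_group_iff [OF a(1)] by blast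
  \<comment> \<open>Bounded sets are closed under binary unions, so their complements form a filter
    base.\<close>
  have ev: "eventually P ?F \<longleftrightarrow> (\<exists>B. coarse_bounded ?E B \<and> (\<forall>x\<in>-B. P x))" for P
  proof (subst eventually_INF_base)
    show "\<exists>x\<in>{B. coarse_bounded ?E B}. principal (- x) \<le> inf (principal (- B)) (principal (- B'))"
      if "B \<in> {B. coarse_bounded ?E B}" "B' \<in> {B. coarse_bounded ?E B}" for B B'
      using that union by (intro bexI [of _ "B \<union> B'"]) auto
  qed (use empty in \<open>auto simp: eventually_principal\<close>)
  have "?F \<noteq> bot"
    unfolding trivial_limit_def ev
    using not_coarse_bounded_UNIV [OF a] by (metis ComplI UNIV_eq_I)
  then obtain p where p: "p \<le> ?F" "ultrafilter p"
    by (rule ultrafilter_below)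
  have "\<not> coarse_bounded ?E P" if "mem_filter P p" for P
  proof
    assume "coarse_bounded ?E P"
    then have "eventually (\<lambda>x. x \<in> - P) ?F"
      unfolding ev by blast
    then have "mem_filter (- P) p"
      using p(1) by (simp add: mem_filter_def le_filter_def)
    with that p(2) show False
      by (simp add: ultrafilter_Compl)
  qed
  with p(2) show ?thesis
    by (auto simp: unbounded_ultrafilters_def)
qed

text \<open>A single entourage suffices, the one whose ball at \<open>x\<close> consists of
  \<open>x\<close> and all \<open>x + a n\<close>. A convergent sequence together with its limit is
  compact, so this entourage is available.\<close>

lemma slowly_oscillating_imp_constant_outside_bounded:
  assumes a: "T_sequence a" "\<not> trivial_sequence a" "group_closure (range a) = UNIV"
    and f: "slowly_oscillating (coarse_group (precompact_ideal a)) f"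
  obtains B where "coarse_bounded (coarse_group (precompact_ideal a)) B"
    "\<And>x y. x \<notin> B \<Longrightarrow> y \<notin> B \<Longrightarrow> f x = f y"
proof -
  let ?T = "strongest_topology a" and ?E = "coarse_group (precompact_ideal a)"
  have T: "group_topology ?T" "Hausdorff_space ?T" "limitin ?T a 0 sequentially"
    using strongest_topology [OF a(1)] Hausdorff_strongest_topology [OF a(1)]
    by (auto simp: is_strongest_topology_def)
  \<comment> \<open>The sign is reversed because entourages are given by \<open>x - y\<close>: the
    point \<open>y = x + a n\<close> yields \<open>- a n\<close>.\<close>
  define P where "P = (\<lambda>k. 0 - k) ` insert 0 (range a)"
  have "compactin ?T (insert 0 (range a))"
    using T by (intro compactin_sequence_with_limit) (auto simp: group_topology_def)
  then have "compactin ?T P"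
    unfolding P_def using continuous_map_diff_left [OF T(1)] by (rule image_compactin)
  then have "P \<in> precompact_ideal a"
    unfolding precompact_ideal_iff [OF a(1)] by blast
  then have "{(x, y). x - y \<in> P} \<in> ?E"
    by (rule group_entourage_in_coarse_group) (simp add: P_def)
  with f obtain B where "coarse_bounded ?E B"
    and B: "\<And>x. x \<notin> B \<Longrightarrow> f constant_on {(x, y). x - y \<in> P} `` {x}"
    unfolding slowly_oscillating_def by blast
  then obtain K where K: "compactin ?T K" "B \<subseteq> K"
    unfolding coarse_bounded_coarse_group_iff [OF a(1)] by blast
  have "f (x + a n) = f x" if "x \<notin> K" for x n
  proof -
    have "x + a n \<in> {(x, y). x - y \<in> P} `` {x}" "x \<in> {(x, y). x - y \<in> P} `` {x}"
      by (auto simp: P_def)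
    moreover have "x \<notin> B" using that K(2) by blast
    ultimately show ?thesis
      using B [of x] unfolding constant_on_def by metis
  qed
  then have "f x = f y" if "x \<notin> K" "y \<notin> K" for x y
    using constant_outside_compact [OF T a(2,3) K(1)] that by blast
  moreover have "coarse_bounded ?E K"
    unfolding coarse_bounded_coarse_group_iff [OF a(1)] using K(1) by blast
  ultimately show thesis
    using that by blast
qed

theorem theorem4:
  fixes a :: "nat \<Rightarrow> 'a::ab_group_add"
  assumes "T_sequence a"
    and "\<not> trivial_sequence a"
    and "group_closure (range a) = UNIV"
  shows "is_singleton (topspace (space_of_ends (coarse_group (precompact_ideal a))))"
proof -
  let ?E = "coarse_group (precompact_ideal a)"
  \<comment> \<open>Every unbounded ultrafilter contains \<open>- B\<close>, where \<open>f\<close>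
    is constant. One implication is enough, since \<open>p\<close> and \<open>q\<close> may be
    exchanged.\<close>
  have ext: "stone_ext f p"
    if pq: "p \<in> unbounded_ultrafilters ?E" "q \<in> unbounded_ultrafilters ?E"
      and f: "slowly_oscillating ?E f" and q: "stone_ext f q" for p q f
  proof -
    from f obtain B where B: "coarse_bounded ?E B" "\<And>x y. x \<notin> B \<Longrightarrow> y \<notin> B \<Longrightarrow> f x = f y"
      using slowly_oscillating_imp_constant_outside_bounded [OF assms] by blast
    have ultra: "ultrafilter p" "ultrafilter q" "mem_filter (- B) p"
      using pq B(1) ultrafilter_Compl by (auto simp: unbounded_ultrafilters_def)
    have "mem_filter {x. f x} q"
      using q ultra(2) by (simp add: stone_ext_iff)
    \<comment> \<open>A member of \<open>q\<close> is unbounded, so \<open>f\<close> is true at some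
      point outside \<open>B\<close>, hence everywhere outside \<open>B\<close>.\<close>
    then have "\<not> {x. f x} \<subseteq> B"
      using pq(2) B(1) mem_filter_mono by (auto simp: unbounded_ultrafilters_def)
    then have "- B \<subseteq> {x. f x}"
      using B(2) by blast
    then show ?thesis
      using ultra mem_filter_mono by (simp add: stone_ext_iff)
  qed
  obtain p where p: "p \<in> unbounded_ultrafilters ?E"
    using unbounded_ultrafilters_nonempty [OF assms] by blast
  have "ends_rel ?E = unbounded_ultrafilters ?E \<times> unbounded_ultrafilters ?E"
    using ext by (auto simp: ends_rel_def)
  then have "unbounded_ultrafilters ?E // ends_rel ?E = {unbounded_ultrafilters ?E}"
    using p by (auto simp: quotient_def)
  then show ?thesis
    by (simp add: topspace_space_of_ends)
qed

end
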